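(* Fix an integer $d\geq 2$, and for $k\in\mathbb{N}$ let $T(d,k)$ be the rooted tree of depth $k$ in which every vertex at levels $0,1,\dots,k-1$ has exactly $d$ children (so level $i$ has $d^i$ vertices and the leaves are at level $k$). Then \[k-O(\sqrt{k\log k})\leq \mathrm{dct}(T(d,k))\leq k.\] In particular $\mathrm{dct}(T(d,k))=(1+o(1))k$ and the cost of drunkenness satisfies $F(T(d,k))=\mathrm{ct}(T(d,k))/\mathrm{dct}(T(d,k))=1+o(1)$, where asymptotics are as $k\to\infty$.
   Context: Cops and robber game on a finite connected graph $G=(V,E)$ with $m$ cops: in round $0$ the cops choose positions $x\in V^m$, then the robber chooses his initial vertex; in each round $t\ge1$ first each cop moves along an edge or stays, then the robber moves. Capture time is the first time a cop and the robber occupy the same vertex. The cop number $c(G)$ is the minimum $m$ for which the cops can guarantee capture of a robber who sees everything and plays optimally (for trees $c=1$). $\mathrm{ct}_{x,y}(G,m)$ is the capture time from $(x,y)$ under optimal play (cops minimizing, robber maximizing); $\mathrm{ct}(G,m)=\min_{x}\max_{y}\mathrm{ct}_{x,y}(G,m)$ and $\mathrm{ct}(G)=\mathrm{ct}(G,c(G))$. In the drunk robber version, after the cops choose $x$ the robber's initial vertex is uniformly random in $V$, and in each round the robber moves to a uniformly random neighbour of his current vertex (open neighbourhood; he never stays), independently of the cops; the cops see him. $\mathrm{dct}_{x,y}(G,m)$ is the expected capture time from $(x,y)$ when the cops play to minimize it, $\mathrm{dct}(G,m)=\min_{x\in V^m}\frac{1}{|V|}\sum_{y\in V}\mathrm{dct}_{x,y}(G,m)$,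 $\mathrm{dct}(G)=\mathrm{dct}(G,c(G))$, and $F(G)=\mathrm{ct}(G)/\mathrm{dct}(G)$. *)

theory Defs
  imports
    "HOL-Probability.Probability"
    "Graph_Theory.Graph_Theory"
begin

text \<open>
  A finite simple graph is a \<open>pair_graph\<close> in the sense of the Graph Theory library: a finite
  vertex set \<open>pverts G\<close> and a symmetric irreflexive arc relation \<open>parcs G\<close>.
\<close>

definition nbrs :: "'a pair_pre_digraph \<Rightarrow> 'a \<Rightarrow> 'a set" where
  "nbrs G u = {v. (u, v) \<in> parcs G}"

definition cop_positions :: "'a pair_pre_digraph \<Rightarrow> nat \<Rightarrow> 'a list set" where
  "cop_positions G m = {x. length x = m \<and> set x \<subseteq> pverts G}"

definition cops_move :: "'a pair_pre_digraph \<Rightarrow> 'a list \<Rightarrow> 'a list \<Rightarrow> bool" where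
  "cops_move G = list_all2 (\<lambda>u v. v = u \<or> v \<in> nbrs G u)"

text \<open>
  A history lists the positions of the cops and of the robber at the end of the rounds
  \<open>0, \<dots>, t\<close>. In round \<open>t + 1\<close> the cops see it, and the robber also sees where the cops have
  just moved.
\<close>

type_synonym 'a history = "('a list \<times> 'a) list"
type_synonym 'a cop_strategy = "'a history \<Rightarrow> 'a list"
type_synonym 'a robber_strategy = "'a history \<Rightarrow> 'a list \<Rightarrow> 'a"

definition cop_strategies :: "'a pair_pre_digraph \<Rightarrow> 'a cop_strategy set" where
  "cop_strategies G = {\<sigma>. \<forall>h x y. set x \<subseteq> pverts G \<longrightarrow> y \<in> pverts G \<longrightarrow>
     cops_move G x (\<sigma> (h @ [(x, y)]))}"

definition robber_strategies :: "'a pair_pre_digraph \<Rightarrow> 'a robber_strategy set" where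
  "robber_strategies G = {\<rho>. \<forall>h x y x'. set x \<subseteq> pverts G \<longrightarrow> y \<in> pverts G \<longrightarrow>
     set x' \<subseteq> pverts G \<longrightarrow> \<rho> (h @ [(x, y)]) x' \<in> insert y (nbrs G y)}"

primrec play :: "'a list \<Rightarrow> 'a \<Rightarrow> 'a cop_strategy \<Rightarrow> 'a robber_strategy \<Rightarrow> nat \<Rightarrow> 'a history" where
  "play x y \<sigma> \<rho> 0 = [(x, y)]"
| "play x y \<sigma> \<rho> (Suc t) =
     (let h = play x y \<sigma> \<rho> t; x' = \<sigma> h in h @ [(x', \<rho> h x')])"

definition cops_at :: "'a list \<Rightarrow> 'a \<Rightarrow> 'a cop_strategy \<Rightarrow> 'a robber_strategy \<Rightarrow> nat \<Rightarrow> 'a list" where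
  "cops_at x y \<sigma> \<rho> t = fst (last (play x y \<sigma> \<rho> t))"

definition robber_at :: "'a list \<Rightarrow> 'a \<Rightarrow> 'a cop_strategy \<Rightarrow> 'a robber_strategy \<Rightarrow> nat \<Rightarrow> 'a" where
  "robber_at x y \<sigma> \<rho> t = snd (last (play x y \<sigma> \<rho> t))"

text \<open>
  In a round \<open>t \<ge> 1\<close> the robber is caught either by the cops' move, when he is still at his old
  vertex, or by moving onto a cop himself.
\<close>

definition caught_in_round ::
  "'a list \<Rightarrow> 'a \<Rightarrow> 'a cop_strategy \<Rightarrow> 'a robber_strategy \<Rightarrow> nat \<Rightarrow> bool" where
  "caught_in_round x y \<sigma> \<rho> t \<longleftrightarrow>
     robber_at x y \<sigma> \<rho> t \<in> set (cops_at x y \<sigma> \<rho> t) \<or>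
     (t \<ge> 1 \<and> robber_at x y \<sigma> \<rho> (t - 1) \<in> set (cops_at x y \<sigma> \<rho> t))"

text \<open>This is \<open>\<infinity>\<close> if the robber is never caught. Moves made after the capture are irrelevant.\<close>

definition capture_time ::
  "'a list \<Rightarrow> 'a \<Rightarrow> 'a cop_strategy \<Rightarrow> 'a robber_strategy \<Rightarrow> enat" where
  "capture_time x y \<sigma> \<rho> = (INF t\<in>{t. caught_in_round x y \<sigma> \<rho> t}. enat t)"

definition cop_number :: "'a pair_pre_digraph \<Rightarrow> nat" where
  "cop_number G = (LEAST m. \<exists>x\<in>cop_positions G m. \<exists>\<sigma>\<in>cop_strategies G.
     \<forall>y\<in>pverts G. \<forall>\<rho>\<in>robber_strategies G. \<exists>t. caught_in_round x y \<sigma> \<rho> t)"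

definition ct_from :: "'a pair_pre_digraph \<Rightarrow> 'a list \<Rightarrow> 'a \<Rightarrow> enat" where
  "ct_from G x y = (INF \<sigma>\<in>cop_strategies G. SUP \<rho>\<in>robber_strategies G. capture_time x y \<sigma> \<rho>)"

definition ct_cops :: "'a pair_pre_digraph \<Rightarrow> nat \<Rightarrow> enat" where
  "ct_cops G m = (INF x\<in>cop_positions G m. SUP y\<in>pverts G. ct_from G x y)"

definition ct :: "'a pair_pre_digraph \<Rightarrow> enat" where
  "ct G = ct_cops G (cop_number G)"

text \<open>
  A connected graph has an isolated vertex only if it is a single vertex; there the walk is taken
  to be constant.
\<close>

definition drunk_step :: "'a pair_pre_digraph \<Rightarrow> 'a \<Rightarrow> 'a pmf" where
  "drunk_step G u = (if nbrs G u = {} then return_pmf u else pmf_of_set (nbrs G u))"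

definition drunk_kernel :: "'a pair_pre_digraph \<Rightarrow> 'a \<Rightarrow> nat \<Rightarrow> (nat \<Rightarrow> 'a) \<Rightarrow> 'a measure" where
  "drunk_kernel G y n w =
     measure_pmf (case n of 0 \<Rightarrow> return_pmf y | Suc i \<Rightarrow> drunk_step G (w i))"

interpretation drunk: Ionescu_Tulcea "drunk_kernel G y" "\<lambda>_. count_space UNIV"
  for G :: "'a pair_pre_digraph" and y :: 'a
proof (rule Ionescu_Tulcea.intro)
  fix i :: nat
  show "drunk_kernel G y i \<in> measurable (PiM {0..<i} (\<lambda>_. count_space UNIV))
          (subprob_algebra (count_space UNIV))"
  proof (cases i)
    case 0
    have "measure_pmf (return_pmf y) \<in> space (subprob_algebra (count_space UNIV))"
      by (simp add: space_subprob_algebra prob_space_imp_subprob_space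
          measure_pmf.prob_space_axioms)
    then show ?thesis
      unfolding drunk_kernel_def 0 by simp
  next
    case (Suc j)
    have "(\<lambda>w. w j) \<in> measurable (PiM {0..<i} (\<lambda>_. count_space (UNIV :: 'a set))) (count_space UNIV)"
      using Suc by (intro measurable_component_singleton) auto
    moreover have "(\<lambda>u. measure_pmf (drunk_step G u)) \<in>
        measurable (count_space UNIV) (subprob_algebra (count_space UNIV))"
      by (auto simp: space_subprob_algebra prob_space_imp_subprob_space
          measure_pmf.prob_space_axioms)
    ultimately show ?thesis
      unfolding drunk_kernel_def Suc by (simp add: measurable_compose)
  qed
next
  fix i :: nat and w :: "nat \<Rightarrow> 'a"
  show "prob_space (drunk_kernel G y i w)"
    by (simp add: drunk_kernel_def measure_pmf.prob_space_axioms)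
qed

text \<open>The law of the simple random walk on \<open>G\<close> started at \<open>y\<close>, on infinite trajectories.\<close>

definition drunk_walk :: "'a pair_pre_digraph \<Rightarrow> 'a \<Rightarrow> (nat \<Rightarrow> 'a) measure" where
  "drunk_walk G y = drunk.PF.lim G y"

text \<open>The robber who follows the trajectory \<open>w\<close>, whatever the cops do.\<close>

definition follow :: "(nat \<Rightarrow> 'a) \<Rightarrow> 'a robber_strategy" where
  "follow w = (\<lambda>h x'. w (length h))"

definition dct_from :: "'a pair_pre_digraph \<Rightarrow> 'a list \<Rightarrow> 'a \<Rightarrow> ennreal" where
  "dct_from G x y = (INF \<sigma>\<in>cop_strategies G.
     \<integral>\<^sup>+ w. ennreal_of_enat (capture_time x y \<sigma> (follow w)) \<partial>drunk_walk G y)"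

definition dct_cops :: "'a pair_pre_digraph \<Rightarrow> nat \<Rightarrow> ennreal" where
  "dct_cops G m = (INF x\<in>cop_positions G m.
     (\<Sum>y\<in>pverts G. dct_from G x y) / of_nat (card (pverts G)))"

definition dct :: "'a pair_pre_digraph \<Rightarrow> ennreal" where
  "dct G = dct_cops G (cop_number G)"

definition drunkenness_cost :: "'a pair_pre_digraph \<Rightarrow> ennreal" where
  "drunkenness_cost G = ennreal_of_enat (ct G) / dct G"

text \<open>
  A vertex at level \<open>i\<close> is a word of length \<open>i\<close> over \<open>{..<d}\<close>; the root is the empty word and the
  children of \<open>u\<close> are the words \<open>j # u\<close>.
\<close>

definition regular_tree :: "nat \<Rightarrow> nat \<Rightarrow> nat list pair_pre_digraph" where
  "regular_tree d k =
     (let V = {v. set v \<subseteq> {..<d} \<and> length v \<le> k}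
      in \<lparr> pverts = V, parcs = {(u, v). u \<in> V \<and> v \<in> V \<and> (\<exists>j. v = j # u \<or> u = j # v)} \<rparr>)"

lemma pair_graph_regular_tree: "pair_graph (regular_tree d k)"
proof -
  let ?T = "regular_tree d k"
  have fin: "finite (pverts ?T)"
    by (simp add: regular_tree_def Let_def finite_lists_length_le)
  have sub: "parcs ?T \<subseteq> pverts ?T \<times> pverts ?T"
    by (auto simp: regular_tree_def Let_def)
  show ?thesis
  proof
    show "finite (parcs ?T)"
      using fin sub finite_subset by blast
    show "symmetric (with_proj ?T)"
      by (auto simp: symmetric_def sym_def regular_tree_def Let_def)
    show "fst e \<in> pverts ?T" "snd e \<in> pverts ?T" if "e \<in> parcs ?T" for e
      using that sub by auto
    show "fst e \<noteq> snd e" if "e \<in> parcs ?T" for e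
      using that by (auto simp: regular_tree_def Let_def)
  qed (rule fin)
qed

lemma connected_regular_tree: "connected (with_proj (regular_tree d k))"
proof -
  let ?T = "regular_tree d k"
  let ?R = "rtrancl_on (pverts ?T) ((parcs ?T)\<^sup>s)"
  interpret pair_graph ?T by (rule pair_graph_regular_tree)
  have to_root: "(v, []) \<in> ?R \<and> ([], v) \<in> ?R" if "v \<in> pverts ?T" for v
    using that
  proof (induction v)
    case Nil
    then show ?case by auto
  next
    case (Cons j u)
    have u: "u \<in> pverts ?T"
      using Cons.prems by (auto simp: regular_tree_def Let_def)
    have "(j # u, u) \<in> (parcs ?T)\<^sup>s" "(u, j # u) \<in> (parcs ?T)\<^sup>s"
      using u Cons.prems by (auto simp: symcl_def regular_tree_def Let_def)
    then show ?case
      using Cons.IH[OF u] u Cons.prems converse_rtrancl_on_into_rtrancl_on[of "j # u" u]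
        rtrancl_on_into_rtrancl_on[of "[]" u _ _ "j # u"] by blast
  qed
  moreover have "[] \<in> pverts ?T"
    by (simp add: regular_tree_def Let_def)
  ultimately show ?thesis
    unfolding connected_conv with_proj_simps using rtrancl_on_trans[of _ "[]"] by blast
qed

end

theory Submission
  imports Defs "HOL-Library.Sublist" "HOL-Real_Asymp.Real_Asymp"
begin

text \<open>
  For the upper bounds a single cop starts at the root and always descends towards the robber, so
  that after \<open>t\<close> rounds he is the ancestor of the robber at level \<open>t\<close>. For the lower bound, whatever
  the cop does, after \<open>t\<close> rounds he is in the ball of radius \<open>t\<close> around his initial vertex, which
  has \<open>O(d\<^sup>t)\<close> vertices. The uniform initial distribution is dominated by the degree measure,
  which is stationary, so each vertex carries the robber at a given time with probability
  \<open>O(d\<^sup>-\<^sup>k)\<close>. Summing over \<open>t < k\<close>, the expected number of rounds lost with respect to \<open>k\<close> is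
  bounded by \<open>\<Sum>\<^sub>t (k - t) O(d\<^sup>t\<^sup>-\<^sup>k) = O(1)\<close>, which is stronger than the stated error term.
\<close>

section \<open>Marginals of the trajectory measure on initial segments\<close>

text \<open>For an initial segment the cut-off \<open>up_to\<close> is \<open>n\<close> itself, so
  restricting the composition of the first \<open>n\<close> kernels changes nothing.\<close>

lemma (in Ionescu_Tulcea) CI_atLeastLessThan: "CI {0..<n} = C 0 n (\<lambda>_. undefined)"
proof -
  have "up_to {0..<n} = n"
    using up_to_iff_Ico[of "{0..<n}"] by (intro antisym) auto
  then show ?thesis
    unfolding CI_def using distr_C[of n n "\<lambda>_. undefined" 0] by simp
qed

lemma (in Ionescu_Tulcea) nn_integral_lim:
  assumes [measurable]: "f \<in> borel_measurable (PiM {0..<n} M)"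
  shows "(\<integral>\<^sup>+w. f (restrict w {0..<n}) \<partial>PF.lim) = (\<integral>\<^sup>+w. f w \<partial>C 0 n (\<lambda>_. undefined))"
proof -
  have "(\<lambda>w. restrict w {0..<n}) \<in> measurable PF.lim (PiM {0..<n} M)"
    by (auto intro!: measurable_restrict measurable_component_singleton
        simp: measurable_cong_sets[OF PF.sets_lim refl])
  then have "(\<integral>\<^sup>+w. f (restrict w {0..<n}) \<partial>PF.lim) =
      (\<integral>\<^sup>+w. f w \<partial>distr PF.lim (PiM {0..<n} M) (\<lambda>w. restrict w {0..<n}))"
    by (simp add: nn_integral_distr)
  then show ?thesis
    by (simp add: distr_lim CI_atLeastLessThan)
qed

text \<open>Both sides pass to the finite compositions, where step \<open>Suc n\<close> is by
  construction a bind of step \<open>n\<close> with the extended kernel \<open>eP n\<close>.\<close>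

lemma (in Ionescu_Tulcea) nn_integral_lim_Suc:
  assumes f[measurable]: "f \<in> borel_measurable (PiM {0..<Suc n} M)"
  shows "(\<integral>\<^sup>+w. f (restrict w {0..<Suc n}) \<partial>PF.lim) =
    (\<integral>\<^sup>+w. \<integral>\<^sup>+x. f ((restrict w {0..<n})(n := x)) \<partial>P n (restrict w {0..<n}) \<partial>PF.lim)"
proof -
  let ?C = "\<lambda>n. C 0 n (\<lambda>_. undefined)"
  have 0: "(\<lambda>_. undefined) \<in> space (PiM {0..<0} M)"
    by simp
  have [measurable]: "(\<lambda>w. \<integral>\<^sup>+x. f x \<partial>eP n w) \<in> borel_measurable (PiM {0..<n} M)"
    by measurable
  have "(\<integral>\<^sup>+w. f (restrict w {0..<Suc n}) \<partial>PF.lim) = (\<integral>\<^sup>+w. f w \<partial>?C (Suc n))"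
    by (rule nn_integral_lim) measurable
  also have "\<dots> = (\<integral>\<^sup>+w. \<integral>\<^sup>+x. f x \<partial>eP n w \<partial>?C n)"
  proof -
    have "eP n \<in> measurable (?C n) (subprob_algebra (PiM {0..<Suc n} M))"
      using measurable_eP[of n] by (simp add: measurable_cong_sets[OF sets_C[OF 0] refl])
    then show ?thesis
      by (simp add: nn_integral_bind[where B="PiM {0..<Suc n} M"])
  qed
  also have "\<dots> = (\<integral>\<^sup>+w. \<integral>\<^sup>+x. f x \<partial>eP n (restrict w {0..<n}) \<partial>PF.lim)"
    by (rule nn_integral_lim[symmetric]) measurable
  also have "\<dots> = (\<integral>\<^sup>+w. \<integral>\<^sup>+x. f ((restrict w {0..<n})(n := x)) \<partial>P n (restrict w {0..<n}) \<partial>PF.lim)"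
    by (intro nn_integral_cong nn_integral_eP) (auto simp: space_PiM)
  finally show ?thesis .
qed

section \<open>The simple random walk: initial law and Markov step\<close>

lemma space_drunk_walk [simp]: "space (drunk_walk G y) = UNIV"
  by (simp add: drunk_walk_def space_PiM)

lemma sets_drunk_walk [measurable_cong]:
  "sets (drunk_walk G y) = sets (PiM UNIV (\<lambda>_. count_space UNIV))"
  by (simp add: drunk_walk_def)

lemma measurable_drunk_walk_component [measurable]:
  "(\<lambda>w. w n) \<in> measurable (drunk_walk G y) (count_space UNIV)"
  using measurable_component_singleton[of n UNIV "\<lambda>_. count_space UNIV"]
  by (simp add: measurable_cong_sets[OF sets_drunk_walk refl])

lemma nn_integral_drunk_walk_0: "(\<integral>\<^sup>+w. g (w 0) \<partial>drunk_walk G y) = g y"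
proof -
  have m: "(\<lambda>w. g (w 0)) \<in> borel_measurable (PiM {0..<Suc 0} (\<lambda>_. count_space UNIV))"
    by (rule measurable_compose[OF measurable_component_singleton]) auto
  \<comment> \<open>The total mass enters because the instance \<open>n = 0\<close> of the recursion
    leaves a constant to be integrated over all trajectories.\<close>
  have "emeasure (drunk_walk G y) UNIV = 1"
  proof -
    interpret prob_space "drunk.C G y 0 0 (\<lambda>_. undefined)"
      by (rule drunk.prob_space_C) simp
    show ?thesis
      using drunk.nn_integral_lim[where f = "\<lambda>_. 1" and n = 0 and G = G and y = y] emeasure_space_1
      by (simp flip: drunk_walk_def)
  qed
  then show ?thesis
    using drunk.nn_integral_lim_Suc[OF m, where G = G and y = y]
    by (simp add: drunk_kernel_def flip: drunk_walk_def)
qed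

lemma nn_integral_drunk_walk_Suc:
  fixes y :: "'a :: countable"
  shows "(\<integral>\<^sup>+w. g (w n) (w (Suc n)) \<partial>drunk_walk G y) =
    (\<integral>\<^sup>+w. \<integral>\<^sup>+v. g (w n) v \<partial>drunk_step G (w n) \<partial>drunk_walk G y)"
proof -
  have m: "(\<lambda>w. g (w n) (w (Suc n))) \<in>
      borel_measurable (PiM {0..<Suc (Suc n)} (\<lambda>_. count_space (UNIV :: 'a set)))"
    \<comment> \<open>Countability of the vertex type lets joint measurability be checked separately
      for each value of \<open>w n\<close>.\<close>
    by (rule measurable_compose_countable[where g = "\<lambda>w. w n"])
      (auto intro: measurable_compose[OF measurable_component_singleton]
        measurable_component_singleton)
  then show ?thesis
    using drunk.nn_integral_lim_Suc[OF m, where G = G and y = y]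
    by (simp add: drunk_kernel_def flip: drunk_walk_def)
qed

lemma prob_space_drunk_walk: "prob_space (drunk_walk G y)"
  using nn_integral_drunk_walk_0[where g = "\<lambda>_. 1" and G = G and y = y] by (intro prob_spaceI) simp

section \<open>Legal trajectories and the degree measure\<close>

lemma nbrs_subset:
  assumes "pair_graph G"
  shows "nbrs G u \<subseteq> pverts G"
proof -
  interpret pair_graph G by (rule assms)
  show ?thesis
    by (auto simp: nbrs_def dest: in_arcsD2)
qed

lemma finite_nbrs:
  assumes "pair_graph G"
  shows "finite (nbrs G u)"
proof -
  interpret pair_graph G by (rule assms)
  show ?thesis
    using nbrs_subset[OF assms] by (rule finite_subset) simp
qed

lemma nbrs_sym:
  assumes "pair_graph G" and "v \<in> nbrs G u"
  shows "u \<in> nbrs G v"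
proof -
  interpret pair_graph G by (rule assms)
  show ?thesis
    using assms(2) by (auto simp: nbrs_def dest: arcs_symmetric)
qed

text \<open>Common ground for the two versions of the game: every play of a legal robber and almost
  every drunk trajectory has this property, so the chase is analysed only once.\<close>

definition lazy_walk :: "'a pair_pre_digraph \<Rightarrow> (nat \<Rightarrow> 'a) \<Rightarrow> bool" where
  "lazy_walk G r \<longleftrightarrow> r 0 \<in> pverts G \<and> (\<forall>t. r (Suc t) \<in> insert (r t) (nbrs G (r t)))"

lemma lazy_walk_in_verts:
  assumes "pair_graph G" "lazy_walk G r"
  shows "r t \<in> pverts G"
proof (induction t)
  case 0
  then show ?case
    using assms by (simp add: lazy_walk_def)
next
  case (Suc t)
  then show ?case
    using assms nbrs_subset[of G "r t"] unfolding lazy_walk_def by (metis insertE subsetD)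
qed

lemma AE_drunk_walk:
  fixes y :: "'a :: countable"
  assumes G: "pair_graph G" and y: "y \<in> pverts G"
  shows "AE w in drunk_walk G y. w 0 = y \<and> lazy_walk G w"
proof -
  have "AE w in drunk_walk G y. w 0 = y"
  proof -
    have "(\<integral>\<^sup>+w. indicator (- {y}) (w 0) \<partial>drunk_walk G y) = 0"
      by (subst nn_integral_drunk_walk_0) simp
    moreover have "(\<lambda>w. indicator (- {y}) (w 0) :: ennreal) \<in> borel_measurable (drunk_walk G y)"
      by (rule measurable_compose[OF measurable_drunk_walk_component]) simp
    ultimately show ?thesis
      by (subst (asm) nn_integral_0_iff_AE) (auto simp: indicator_eq_0_iff)
  qed
  moreover have "AE w in drunk_walk G y. w (Suc n) \<in> insert (w n) (nbrs G (w n))" for n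
  proof -
    \<comment> \<open>The \<open>insert u\<close> also covers an isolated vertex, where
      \<open>drunk_step\<close> is constant.\<close>
    let ?g = "\<lambda>u v. indicator (- insert u (nbrs G u)) v :: ennreal"
    have "(\<integral>\<^sup>+v. ?g u v \<partial>drunk_step G u) = 0" for u
      using finite_nbrs[OF G, of u]
      by (subst nn_integral_0_iff_AE) (auto simp: AE_measure_pmf_iff drunk_step_def)
    then have "(\<integral>\<^sup>+w. ?g (w n) (w (Suc n)) \<partial>drunk_walk G y) = 0"
      by (subst nn_integral_drunk_walk_Suc) simp
    moreover have "(\<lambda>w. ?g (w n) (w (Suc n))) \<in> borel_measurable (drunk_walk G y)"
      by (rule measurable_compose_countable[where g = "\<lambda>w. w n"])
        (auto intro: measurable_compose[OF measurable_drunk_walk_component])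
    ultimately show ?thesis
      by (subst (asm) nn_integral_0_iff_AE) (auto simp: indicator_eq_0_iff)
  qed
  ultimately show ?thesis
    using y unfolding lazy_walk_def
    by (auto simp: AE_all_countable)
qed

text \<open>
  The counting measure is dominated by the degree measure, which is stationary for the walk.
\<close>

lemma sum_nn_integral_drunk_walk_le:
  fixes G :: "'a :: countable pair_pre_digraph"
  assumes G: "pair_graph G" and deg: "\<And>v. v \<in> pverts G \<Longrightarrow> nbrs G v \<noteq> {}"
  shows "(\<Sum>y\<in>pverts G. \<integral>\<^sup>+w. g (w n) \<partial>drunk_walk G y) \<le>
    (\<Sum>v\<in>pverts G. of_nat (card (nbrs G v)) * g v)"
proof -
  interpret pair_graph G by (rule G)
  note fin = finite_nbrs[OF G]
  show ?thesis
  proof (induction n arbitrary: g)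
    case 0
    have "1 * g v \<le> of_nat (card (nbrs G v)) * g v" if "v \<in> pverts G" for v
    proof -
      have "card (nbrs G v) \<ge> 1"
        using deg[OF that] fin[of v] by (simp add: Suc_le_eq card_gt_0_iff)
      then show ?thesis
        by (intro mult_right_mono) (use of_nat_mono[of 1] in force, simp)
    qed
    then show ?case
      by (simp add: nn_integral_drunk_walk_0 sum_mono)
  next
    case (Suc n)
    \<comment> \<open>One step of the walk replaces \<open>g\<close> by its average over neighbours;
      the induction hypothesis is used for this new function.\<close>
    let ?h = "\<lambda>u. \<integral>\<^sup>+v. g v \<partial>drunk_step G u"
    have h: "of_nat (card (nbrs G u)) * ?h u = (\<Sum>v\<in>nbrs G u. g v)" if "u \<in> pverts G" for u
    proof -
      have "card (nbrs G u) \<noteq> 0"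
        using deg[OF that] fin[of u] by simp
      then show ?thesis
        using deg[OF that] fin[of u]
        by (simp add: drunk_step_def nn_integral_pmf_of_set ennreal_times_divide
            ennreal_mult_divide_eq mult.commute[of "of_nat _"])
    qed
    \<comment> \<open>Reversibility: swapping the ends of an arc permutes the arcs, which is what
      makes the degree measure stationary.\<close>
    have swap: "prod.swap p \<in> (SIGMA u:pverts G. nbrs G u)"
      if "p \<in> (SIGMA u:pverts G. nbrs G u)" for p
      using that nbrs_sym[OF G, of "snd p" "fst p"] nbrs_subset[OF G, of "fst p"] by (cases p) auto
    have "(\<Sum>y\<in>pverts G. \<integral>\<^sup>+w. g (w (Suc n)) \<partial>drunk_walk G y) =
        (\<Sum>y\<in>pverts G. \<integral>\<^sup>+w. ?h (w n) \<partial>drunk_walk G y)"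
      by (simp add: nn_integral_drunk_walk_Suc[where g = "\<lambda>_. g"])
    also have "\<dots> \<le> (\<Sum>u\<in>pverts G. of_nat (card (nbrs G u)) * ?h u)"
      by (rule Suc.IH)
    also have "\<dots> = (\<Sum>u\<in>pverts G. \<Sum>v\<in>nbrs G u. g v)"
      by (simp add: h)
    also have "\<dots> = (\<Sum>(u, v)\<in>(SIGMA u:pverts G. nbrs G u). g v)"
      by (simp add: sum.Sigma fin)
    also have "\<dots> = (\<Sum>(v, u)\<in>(SIGMA v:pverts G. nbrs G v). g v)"
      by (rule sum.reindex_bij_witness[of _ prod.swap prod.swap])
        (simp_all only: swap swap_swap, simp_all add: split_beta)
    also have "\<dots> = (\<Sum>v\<in>pverts G. of_nat (card (nbrs G v)) * g v)"
      by (simp add: sum.Sigma[symmetric] fin)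
    finally show ?case .
  qed
qed

section \<open>Plays of the game and capture times\<close>

lemma cops_at_0 [simp]: "cops_at x y \<sigma> \<rho> 0 = x"
  by (simp add: cops_at_def)

lemma robber_at_0 [simp]: "robber_at x y \<sigma> \<rho> 0 = y"
  by (simp add: robber_at_def)

lemma cops_at_Suc: "cops_at x y \<sigma> \<rho> (Suc t) = \<sigma> (play x y \<sigma> \<rho> t)"
  by (simp add: cops_at_def Let_def)

lemma robber_at_Suc:
  "robber_at x y \<sigma> \<rho> (Suc t) = \<rho> (play x y \<sigma> \<rho> t) (cops_at x y \<sigma> \<rho> (Suc t))"
  by (simp add: robber_at_def cops_at_def Let_def)

lemma length_play [simp]: "length (play x y \<sigma> \<rho> t) = Suc t"
  by (induction t) (simp_all add: Let_def)

lemma last_play: "last (play x y \<sigma> \<rho> t) = (cops_at x y \<sigma> \<rho> t, robber_at x y \<sigma> \<rho> t)"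
  by (simp add: cops_at_def robber_at_def)

lemma play_snoc:
  obtains h where "play x y \<sigma> \<rho> t = h @ [(cops_at x y \<sigma> \<rho> t, robber_at x y \<sigma> \<rho> t)]"
  using append_butlast_last_id[of "play x y \<sigma> \<rho> t"] last_play[of x y \<sigma> \<rho> t] length_play[of x y \<sigma> \<rho> t]
  by (metis list.size(3) nat.distinct(1))

lemma robber_at_follow:
  assumes "w 0 = y"
  shows "robber_at x y \<sigma> (follow w) = w"
proof
  fix t
  show "robber_at x y \<sigma> (follow w) t = w t"
    using assms by (cases t) (simp_all add: robber_at_Suc follow_def)
qed

lemma cops_move_in_verts:
  assumes "pair_graph G" "cops_move G x x'" "set x \<subseteq> pverts G"
  shows "set x' \<subseteq> pverts G"
  using assms(2,3) unfolding cops_move_def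
  by (induction rule: list_all2_induct) (auto dest: subsetD[OF nbrs_subset[OF assms(1)]])

text \<open>\<open>cop_strategies\<close> constrains only moves made from inside the graph, so
  legality and confinement propagate together. The hypothesis on the robber concerns his trajectory
  because \<open>follow w\<close> need not be a legal strategy.\<close>

lemma cops_at_in_verts:
  assumes G: "pair_graph G" and \<sigma>: "\<sigma> \<in> cop_strategies G" and x: "set x \<subseteq> pverts G"
    and r: "\<And>t. robber_at x y \<sigma> \<rho> t \<in> pverts G"
  shows "set (cops_at x y \<sigma> \<rho> t) \<subseteq> pverts G"
    and "cops_move G (cops_at x y \<sigma> \<rho> t) (cops_at x y \<sigma> \<rho> (Suc t))"
proof -
  have move: "cops_move G (cops_at x y \<sigma> \<rho> t) (cops_at x y \<sigma> \<rho> (Suc t))"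
    if "set (cops_at x y \<sigma> \<rho> t) \<subseteq> pverts G" for t
  proof -
    obtain h where "play x y \<sigma> \<rho> t = h @ [(cops_at x y \<sigma> \<rho> t, robber_at x y \<sigma> \<rho> t)]"
      by (rule play_snoc)
    then show ?thesis
      using that \<sigma> r[of t] unfolding cops_at_Suc by (simp add: cop_strategies_def)
  qed
  show in_V: "set (cops_at x y \<sigma> \<rho> t) \<subseteq> pverts G" for t
  proof (induction t)
    case (Suc t)
    then show ?case
      using cops_move_in_verts[OF G move[of t]] by simp
  qed (simp add: x)
  show "cops_move G (cops_at x y \<sigma> \<rho> t) (cops_at x y \<sigma> \<rho> (Suc t))"
    by (rule move[OF in_V])
qed

text \<open>A legal reply of the robber is guaranteed only while the cops are inside the graph,
  hence the simultaneous induction on both positions.\<close>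

lemma lazy_walk_robber_at:
  assumes G: "pair_graph G" and \<sigma>: "\<sigma> \<in> cop_strategies G" and \<rho>: "\<rho> \<in> robber_strategies G"
    and x: "set x \<subseteq> pverts G" and y: "y \<in> pverts G"
  shows "lazy_walk G (robber_at x y \<sigma> \<rho>)"
proof -
  let ?c = "cops_at x y \<sigma> \<rho>" and ?r = "robber_at x y \<sigma> \<rho>"
  have step: "set (?c (Suc t)) \<subseteq> pverts G \<and> ?r (Suc t) \<in> insert (?r t) (nbrs G (?r t))"
    if "set (?c t) \<subseteq> pverts G" "?r t \<in> pverts G" for t
  proof -
    obtain h where h: "play x y \<sigma> \<rho> t = h @ [(?c t, ?r t)]"
      by (rule play_snoc)
    have "cops_move G (?c t) (?c (Suc t))"
      using \<sigma> that unfolding cops_at_Suc h by (simp add: cop_strategies_def)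
    then have c: "set (?c (Suc t)) \<subseteq> pverts G"
      by (rule cops_move_in_verts[OF G _ that(1)])
    then show ?thesis
      using \<rho> that unfolding robber_at_Suc h by (simp add: robber_strategies_def)
  qed
  have "set (?c t) \<subseteq> pverts G \<and> ?r t \<in> pverts G" for t
  proof (induction t)
    case 0
    then show ?case
      using x y by simp
  next
    case (Suc t)
    then show ?case
      using step[of t] nbrs_subset[OF G, of "?r t"] by auto
  qed
  then show ?thesis
    using step y by (simp add: lazy_walk_def)
qed

lemma capture_time_le: "caught_in_round x y \<sigma> \<rho> t \<Longrightarrow> t \<le> k \<Longrightarrow> capture_time x y \<sigma> \<rho> \<le> enat k"
  unfolding capture_time_def by (rule INF_lower2[of t]) auto

lemma capture_time_ge:
  "(\<And>t. caught_in_round x y \<sigma> \<rho> t \<Longrightarrow> k \<le> t) \<Longrightarrow> enat k \<le> capture_time x y \<sigma> \<rho>"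
  unfolding capture_time_def by (rule INF_greatest) auto

text \<open>The motionless robber is enough for the lower bounds on \<open>cop_number\<close> and
  \<open>ct\<close>.\<close>

definition stay :: "'a robber_strategy" where
  "stay = (\<lambda>h x'. snd (last h))"

lemma stay_in_robber_strategies: "stay \<in> robber_strategies G"
  by (simp add: stay_def robber_strategies_def)

lemma robber_at_stay [simp]: "robber_at x y \<sigma> stay t = y"
  by (induction t) (simp_all add: robber_at_Suc stay_def last_play)

section \<open>Lower bound for the drunk game through the reach of one cop\<close>

primrec graph_ball :: "'a pair_pre_digraph \<Rightarrow> 'a \<Rightarrow> nat \<Rightarrow> 'a set" where
  "graph_ball G c 0 = {c}"
| "graph_ball G c (Suc t) = graph_ball G c t \<union> (\<Union>u\<in>graph_ball G c t. nbrs G u)"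

lemma graph_ball_subset: "pair_graph G \<Longrightarrow> c \<in> pverts G \<Longrightarrow> graph_ball G c t \<subseteq> pverts G"
  by (induction t) (auto dest: nbrs_subset)

lemma cops_at_in_graph_ball:
  assumes G: "pair_graph G" and \<sigma>: "\<sigma> \<in> cop_strategies G" and c: "c \<in> pverts G"
    and r: "\<And>t. robber_at [c] y \<sigma> \<rho> t \<in> pverts G"
  shows "set (cops_at [c] y \<sigma> \<rho> t) \<subseteq> graph_ball G c t"
proof (induction t)
  case (Suc t)
  have "cops_move G (cops_at [c] y \<sigma> \<rho> t) (cops_at [c] y \<sigma> \<rho> (Suc t))"
    using c by (intro cops_at_in_verts(2)[OF G \<sigma> _ r]) simp
  then show ?case
    using Suc.IH by (fastforce simp: cops_move_def list_all2_conv_all_nth in_set_conv_nth)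
qed simp

text \<open>Both forms of capture refer to the cop after his move in round \<open>t\<close>, so the
  radius is \<open>t\<close> even when the robber is still at his vertex of time
  \<open>t - 1\<close>.\<close>

lemma caught_in_graph_ball:
  assumes "pair_graph G" "\<sigma> \<in> cop_strategies G" "c \<in> pverts G"
    and "\<And>t. robber_at [c] y \<sigma> \<rho> t \<in> pverts G"
    and "caught_in_round [c] y \<sigma> \<rho> t"
  shows "robber_at [c] y \<sigma> \<rho> t \<in> graph_ball G c t \<or>
    robber_at [c] y \<sigma> \<rho> (t - 1) \<in> graph_ball G c t"
  using assms(5) cops_at_in_graph_ball[OF assms(1-4), of t]
  unfolding caught_in_round_def by blast

text \<open>A capture in round \<open>t < k\<close> loses \<open>k - t\<close> rounds and forces the
  robber into the ball of radius \<open>t\<close> at time \<open>t\<close> or \<open>t - 1\<close>.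
  Charging this loss to the indicators bounds every strategy by the same integral.\<close>

lemma dct_from_lower_bound:
  fixes G :: "'a :: countable pair_pre_digraph"
  assumes G: "pair_graph G" and c: "c \<in> pverts G" and y: "y \<in> pverts G"
  defines "B \<equiv> graph_ball G c"
  shows "of_nat k \<le> dct_from G [c] y + (\<integral>\<^sup>+w. (\<Sum>t<k. of_nat (k - t) *
    (indicator (B t) (w t) + indicator (B t) (w (t - 1)))) \<partial>drunk_walk G y)"
proof -
  define S :: "(nat \<Rightarrow> 'a) \<Rightarrow> ennreal" where
    "S w = (\<Sum>t<k. of_nat (k - t) * (indicator (B t) (w t) + indicator (B t) (w (t - 1))))" for w
  interpret prob_space "drunk_walk G y"
    by (rule prob_space_drunk_walk)
  have [measurable]: "(\<lambda>w. indicator A (w t) :: ennreal) \<in> borel_measurable (drunk_walk G y)" for A t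
    by (rule measurable_compose[OF measurable_drunk_walk_component]) simp
  have S[measurable]: "S \<in> borel_measurable (drunk_walk G y)"
    unfolding S_def by measurable
  have "of_nat k \<le> (\<integral>\<^sup>+w. ennreal_of_enat (capture_time [c] y \<sigma> (follow w)) \<partial>drunk_walk G y) +
      (\<integral>\<^sup>+w. S w \<partial>drunk_walk G y)" if \<sigma>: "\<sigma> \<in> cop_strategies G" for \<sigma>
  proof -
    have path: "of_nat k \<le> S w + ennreal_of_enat (capture_time [c] y \<sigma> (follow w))"
      if w: "w 0 = y" "lazy_walk G w" for w
    proof (cases "\<exists>t<k. caught_in_round [c] y \<sigma> (follow w) t")
      case False
      then have "enat k \<le> capture_time [c] y \<sigma> (follow w)"
        by (intro capture_time_ge) (auto simp: not_less[symmetric])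
      then have "ennreal_of_enat (enat k) \<le> ennreal_of_enat (capture_time [c] y \<sigma> (follow w))"
        by (simp only: ennreal_of_enat_le_iff)
      then show ?thesis
        by (simp add: add_increasing)
    next
      case True
      \<comment> \<open>The first capture round: the capture time pays for \<open>t\<close> rounds,
        and the single summand of \<open>S\<close> with this index pays for the other
        \<open>k - t\<close>.\<close>
      define t where "t = (LEAST t. caught_in_round [c] y \<sigma> (follow w) t)"
      have t: "caught_in_round [c] y \<sigma> (follow w) t"
        using True unfolding t_def by (blast intro: LeastI)
      have "t < k"
        using True unfolding t_def by (blast intro: Least_le le_less_trans)
      have "enat t \<le> capture_time [c] y \<sigma> (follow w)"
        by (intro capture_time_ge) (simp add: t_def Least_le)
      then have "ennreal_of_enat (enat t) \<le> ennreal_of_enat (capture_time [c] y \<sigma> (follow w))"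
        by (simp only: ennreal_of_enat_le_iff)
      then have le: "of_nat t \<le> ennreal_of_enat (capture_time [c] y \<sigma> (follow w))"
        by simp
      have "w t \<in> B t \<or> w (t - 1) \<in> B t"
        using caught_in_graph_ball[OF G \<sigma> c _ t] lazy_walk_in_verts[OF G w(2)] w(1)
        by (simp add: robber_at_follow B_def)
      then have "1 \<le> (indicator (B t) (w t) + indicator (B t) (w (t - 1)) :: ennreal)"
        by (auto simp: indicator_def)
      then have "of_nat (k - t) * 1 \<le>
          of_nat (k - t) * (indicator (B t) (w t) + indicator (B t) (w (t - 1)) :: ennreal)"
        by (intro mult_left_mono) auto
      also have "\<dots> \<le> S w"
        unfolding S_def using \<open>t < k\<close> by (intro member_le_sum) auto
      finally have "of_nat (k - t) + of_nat t \<le> S w + ennreal_of_enat (capture_time [c] y \<sigma> (follow w))"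
        using le by (intro add_mono) simp_all
      then show ?thesis
        using \<open>t < k\<close> by (simp flip: of_nat_add)
    qed
    \<comment> \<open>The strategy is arbitrary and its capture time is not shown to be measurable,
      so it is compared by monotonicity only; additivity is applied to \<open>of_nat k - S w\<close>
      and \<open>S w\<close>.\<close>
    have "AE w in drunk_walk G y.
        of_nat k - S w \<le> ennreal_of_enat (capture_time [c] y \<sigma> (follow w))"
      using AE_drunk_walk[OF G y]
      by eventually_elim (simp add: ennreal_minus_le_iff path)
    then have le: "(\<integral>\<^sup>+w. of_nat k - S w \<partial>drunk_walk G y) \<le>
        (\<integral>\<^sup>+w. ennreal_of_enat (capture_time [c] y \<sigma> (follow w)) \<partial>drunk_walk G y)"
      by (rule nn_integral_mono_AE)
    have "of_nat k = (\<integral>\<^sup>+w. of_nat k \<partial>drunk_walk G y)"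
      using emeasure_space_1 by simp
    also have "\<dots> \<le> (\<integral>\<^sup>+w. (of_nat k - S w) + S w \<partial>drunk_walk G y)"
      by (intro nn_integral_mono, subst add.commute)
        (simp only: ennreal_minus_le_iff[THEN iffD1, THEN conjunct1] order_refl)
    also have "\<dots> = (\<integral>\<^sup>+w. of_nat k - S w \<partial>drunk_walk G y) + (\<integral>\<^sup>+w. S w \<partial>drunk_walk G y)"
      by (intro nn_integral_add) measurable
    finally show ?thesis
      using add_right_mono[OF le] by (rule order_trans)
  qed
  then have "of_nat k - (\<integral>\<^sup>+w. S w \<partial>drunk_walk G y) \<le> dct_from G [c] y"
    unfolding dct_from_def by (intro INF_greatest) (simp add: ennreal_minus_le_iff add.commute)
  then have "of_nat k \<le> dct_from G [c] y + (\<integral>\<^sup>+w. S w \<partial>drunk_walk G y)"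
    by (simp add: ennreal_minus_le_iff add.commute)
  then show ?thesis
    by (simp add: S_def)
qed

text \<open>Summed over all starts, the chances of being in a ball at any fixed time are at most its
  total degree. This holds alike for the times \<open>t\<close> and \<open>t - 1\<close>, whence the
  factor 2.\<close>

lemma sum_dct_from_lower_bound:
  fixes G :: "'a :: countable pair_pre_digraph"
  assumes G: "pair_graph G" and c: "c \<in> pverts G"
    and deg: "\<And>v. v \<in> pverts G \<Longrightarrow> nbrs G v \<noteq> {}"
  shows "of_nat (card (pverts G)) * of_nat k \<le> (\<Sum>y\<in>pverts G. dct_from G [c] y) +
    of_nat (\<Sum>t<k. (k - t) * (2 * (\<Sum>v\<in>graph_ball G c t. card (nbrs G v))))"
proof -
  define B where "B = graph_ball G c"
  let ?D = "\<lambda>t. of_nat (\<Sum>v\<in>B t. card (nbrs G v)) :: ennreal"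
  interpret pair_graph G by (rule G)
  have m[measurable]: "(\<lambda>w. indicator A (w t) :: ennreal) \<in> borel_measurable (drunk_walk G y)" for A t y
    by (rule measurable_compose[OF measurable_drunk_walk_component]) simp
  have bound: "(\<Sum>y\<in>pverts G. \<integral>\<^sup>+w. indicator (B t) (w s) \<partial>drunk_walk G y) \<le> ?D t" for s t
  proof -
    have "(\<Sum>y\<in>pverts G. \<integral>\<^sup>+w. indicator (B t) (w s) \<partial>drunk_walk G y) \<le>
        (\<Sum>v\<in>pverts G. of_nat (card (nbrs G v)) * indicator (B t) v)"
      by (rule sum_nn_integral_drunk_walk_le[OF G deg])
    also have "\<dots> = ?D t"
      using graph_ball_subset[OF G c, of t]
      by (simp add: B_def indicator_def if_distrib sum.If_cases Int_absorb1)
    finally show ?thesis .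
  qed
  have "of_nat (card (pverts G)) * of_nat k = (\<Sum>y\<in>pverts G. of_nat k :: ennreal)"
    by simp
  also have "\<dots> \<le> (\<Sum>y\<in>pverts G. dct_from G [c] y +
      (\<integral>\<^sup>+w. (\<Sum>t<k. of_nat (k - t) *
        (indicator (B t) (w t) + indicator (B t) (w (t - 1)))) \<partial>drunk_walk G y))"
    unfolding B_def by (intro sum_mono dct_from_lower_bound[OF G c])
  also have "\<dots> = (\<Sum>y\<in>pverts G. dct_from G [c] y) + (\<Sum>y\<in>pverts G. \<Sum>t<k. of_nat (k - t) *
      ((\<integral>\<^sup>+w. indicator (B t) (w t) \<partial>drunk_walk G y) +
       (\<integral>\<^sup>+w. indicator (B t) (w (t - 1)) \<partial>drunk_walk G y)))"
    by (simp add: sum.distrib nn_integral_sum nn_integral_cmult nn_integral_add m)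
  also have "\<dots> = (\<Sum>y\<in>pverts G. dct_from G [c] y) + (\<Sum>t<k. of_nat (k - t) *
      ((\<Sum>y\<in>pverts G. \<integral>\<^sup>+w. indicator (B t) (w t) \<partial>drunk_walk G y) +
       (\<Sum>y\<in>pverts G. \<integral>\<^sup>+w. indicator (B t) (w (t - 1)) \<partial>drunk_walk G y)))"
    by (subst sum.swap) (simp only: sum.distrib flip: sum_distrib_left)
  also have "\<dots> \<le> (\<Sum>y\<in>pverts G. dct_from G [c] y) + (\<Sum>t<k. of_nat (k - t) * (?D t + ?D t))"
    by (intro add_left_mono sum_mono mult_left_mono add_mono bound) simp
  also have "(\<Sum>t<k. of_nat (k - t) * (?D t + ?D t)) =
      of_nat (\<Sum>t<k. (k - t) * (2 * (\<Sum>v\<in>graph_ball G c t. card (nbrs G v))))"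
    unfolding B_def by (simp only: of_nat_sum of_nat_mult of_nat_add mult_2)
  finally show ?thesis .
qed

section \<open>Degrees, size and ball growth of the regular tree\<close>

lemma pverts_regular_tree:
  "pverts (regular_tree d k) = {v. set v \<subseteq> {..<d} \<and> length v \<le> k}"
  by (simp add: regular_tree_def Let_def)

lemma mem_nbrs_regular_tree:
  "v \<in> nbrs (regular_tree d k) u \<longleftrightarrow> u \<in> pverts (regular_tree d k) \<and>
    v \<in> pverts (regular_tree d k) \<and> (\<exists>j. v = j # u \<or> u = j # v)"
  by (simp add: nbrs_def regular_tree_def Let_def)

lemma Nil_in_regular_tree [simp]: "[] \<in> pverts (regular_tree d k)"
  by (simp add: pverts_regular_tree)

lemma nbrs_regular_tree_nonempty:
  assumes "d > 0" "k > 0" and v: "v \<in> pverts (regular_tree d k)"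
  shows "nbrs (regular_tree d k) v \<noteq> {}"
proof (cases v)
  case Nil
  then have "[0] \<in> nbrs (regular_tree d k) v"
    using assms by (simp add: mem_nbrs_regular_tree pverts_regular_tree)
  then show ?thesis
    by blast
next
  case (Cons j u)
  then have "u \<in> nbrs (regular_tree d k) v"
    using v by (auto simp: mem_nbrs_regular_tree pverts_regular_tree)
  then show ?thesis
    by blast
qed

lemma card_nbrs_regular_tree_le: "card (nbrs (regular_tree d k) u) \<le> d + 1"
proof -
  \<comment> \<open>\<open>tl u\<close> is the parent; at the root it is the root itself, which only
    enlarges the right-hand side.\<close>
  have "nbrs (regular_tree d k) u \<subseteq> insert (tl u) ((\<lambda>j. j # u) ` {..<d})"
    by (auto simp: mem_nbrs_regular_tree pverts_regular_tree)
  then have "card (nbrs (regular_tree d k) u) \<le> card (insert (tl u) ((\<lambda>j. j # u) ` {..<d}))"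
    by (intro card_mono) auto
  also have "\<dots> \<le> Suc (card ((\<lambda>j. j # u) ` {..<d}))"
    by (rule card_insert_le_m1) auto
  also have "\<dots> \<le> d + 1"
    using card_image_le[of "{..<d}" "\<lambda>j. j # u"] by simp
  finally show ?thesis .
qed

lemma power_le_card_regular_tree: "d ^ k \<le> card (pverts (regular_tree d k))"
proof -
  have "d ^ k = card {v. set v \<subseteq> {..<d} \<and> length v = k}"
    by (simp add: card_lists_length_eq)
  also have "\<dots> \<le> card (pverts (regular_tree d k))"
    by (intro card_mono) (auto simp: pverts_regular_tree finite_lists_length_le)
  finally show ?thesis .
qed

text \<open>Within \<open>t\<close> steps one climbs to the ancestor \<open>drop i c\<close> and descends along \<open>p\<close>.\<close>

lemma graph_ball_regular_tree_subset:
  "graph_ball (regular_tree d k) c t \<subseteq>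
    (\<Union>i\<le>t. (\<lambda>p. p @ drop i c) ` {p. set p \<subseteq> {..<d} \<and> length p \<le> t - i})"
proof (induction t)
  case 0
  have "{p. p = [] \<and> set p \<subseteq> {..<d}} = {[]}"
    by auto
  then show ?case
    by simp
next
  case (Suc t)
  have step: "\<exists>i\<le>Suc t. \<exists>p. v = p @ drop i c \<and> set p \<subseteq> {..<d} \<and> length p \<le> Suc t - i"
    if u: "u = p @ drop i c" "set p \<subseteq> {..<d}" "length p \<le> t - i" "i \<le> t"
      and v: "v = u \<or> v \<in> nbrs (regular_tree d k) u" for u v i p
  proof (cases "v = u")
    case True
    then show ?thesis
      using u by (intro exI[of _ i] conjI exI[of _ p]) auto
  next
    case False
    then obtain j where V: "v \<in> pverts (regular_tree d k)" and j: "v = j # u \<or> u = j # v"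
      using v by (auto simp: mem_nbrs_regular_tree)
    show ?thesis
      using j
    proof
      assume "v = j # u"
      then show ?thesis
        using u V by (intro exI[of _ i] conjI exI[of _ "j # p"]) (auto simp: pverts_regular_tree)
    next
      assume j: "u = j # v"
      show ?thesis
      \<comment> \<open>A step up either climbs to the next ancestor of \<open>c\<close> or undoes
        the latest descent, which is the head of \<open>p\<close>.\<close>
      proof (cases p)
        case Nil
        then have "v = drop (Suc i) c"
          using u(1) j by (metis append_Nil drop_Suc list.sel(3) tl_drop)
        then show ?thesis
          using u(4) by (intro exI[of _ "Suc i"] conjI exI[of _ "[]"]) auto
      next
        case (Cons a q)
        then show ?thesis
          using u j by (intro exI[of _ i] conjI exI[of _ q]) auto
      qed
    qed
  qed
  show ?case
  proof
    fix v
    assume "v \<in> graph_ball (regular_tree d k) c (Suc t)"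
    then obtain u where "u \<in> graph_ball (regular_tree d k) c t"
      and "v = u \<or> v \<in> nbrs (regular_tree d k) u"
      by auto
    moreover from this(1) obtain i p
      where "u = p @ drop i c" "set p \<subseteq> {..<d}" "length p \<le> t - i" "i \<le> t"
      using Suc.IH by blast
    ultimately obtain i p where "i \<le> Suc t" "v = p @ drop i c" "set p \<subseteq> {..<d}" "length p \<le> Suc t - i"
      using step by blast
    then show "v \<in> (\<Union>i\<le>Suc t. (\<lambda>p. p @ drop i c) ` {p. set p \<subseteq> {..<d} \<and> length p \<le> Suc t - i})"
      by blast
  qed
qed

lemma sum_power_atMost_le:
  fixes d :: nat
  assumes "d \<ge> 2"
  shows "(\<Sum>i\<le>n. d ^ i) \<le> 2 * d ^ n"
proof (induction n)
  case (Suc n)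
  have "2 * d ^ n \<le> d * d ^ n"
    using assms by (rule mult_right_mono) simp
  then show ?case
    using Suc.IH unfolding sum.atMost_Suc power_Suc by linarith
qed simp

text \<open>The weights cost only a constant factor, since the largest powers have the smallest
  weights. Raising \<open>k\<close> by one adds a geometric sum, and
  \<open>2 + 2 \<le> 2 * d\<close> closes the induction.\<close>

lemma sum_diff_mult_power_le:
  fixes d :: nat
  assumes "d \<ge> 2"
  shows "(\<Sum>t<k. (k - t) * d ^ t) \<le> 2 * d ^ k"
proof (induction k)
  case (Suc k)
  have "(\<Sum>t<Suc k. (Suc k - t) * d ^ t) = (\<Sum>t<k. (k - t) * d ^ t + d ^ t) + d ^ k"
    by (simp add: Suc_diff_le algebra_simps cong: sum.cong_simp)
  also have "\<dots> = (\<Sum>t<k. (k - t) * d ^ t) + (\<Sum>t\<le>k. d ^ t)"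
    by (simp add: sum.distrib flip: lessThan_Suc_atMost)
  also have "\<dots> \<le> 2 * (2 * d ^ k)"
    using Suc.IH sum_power_atMost_le[OF assms, of k] by simp
  also have "\<dots> \<le> 2 * d ^ Suc k"
    using assms by simp
  finally show ?case .
qed simp

text \<open>Two nested geometric sums, over the height of the climb and over the length of the
  descent, each contribute a factor 2.\<close>

lemma card_graph_ball_regular_tree_le:
  assumes "d \<ge> 2"
  shows "card (graph_ball (regular_tree d k) c t) \<le> 4 * d ^ t"
proof -
  let ?P = "\<lambda>i. {p. set p \<subseteq> {..<d} \<and> length p \<le> t - i}"
  have fin: "finite (?P i)" for i
    by (simp add: finite_lists_length_le)
  have "card (graph_ball (regular_tree d k) c t) \<le> card (\<Union>i\<le>t. (\<lambda>p. p @ drop i c) ` ?P i)"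
    by (intro card_mono graph_ball_regular_tree_subset) (auto intro: fin)
  also have "\<dots> \<le> (\<Sum>i\<le>t. card ((\<lambda>p. p @ drop i c) ` ?P i))"
    by (rule card_UN_le) simp
  also have "\<dots> \<le> (\<Sum>i\<le>t. 2 * d ^ (t - i))"
  proof (rule sum_mono)
    fix i
    have "card ((\<lambda>p. p @ drop i c) ` ?P i) \<le> card (?P i)"
      by (rule card_image_le[OF fin])
    also have "\<dots> = (\<Sum>j\<le>t - i. d ^ j)"
      by (simp add: card_lists_length_le)
    also have "\<dots> \<le> 2 * d ^ (t - i)"
      by (rule sum_power_atMost_le[OF assms])
    finally show "card ((\<lambda>p. p @ drop i c) ` ?P i) \<le> 2 * d ^ (t - i)" .
  qed
  also have "\<dots> = 2 * (\<Sum>i\<le>t. d ^ i)"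
    by (simp add: sum_distrib_left)
      (rule sum.reindex_bij_witness[of _ "\<lambda>i. t - i" "\<lambda>i. t - i"], auto)
  also have "\<dots> \<le> 4 * d ^ t"
    using sum_power_atMost_le[OF assms, of t] by simp
  finally show ?thesis .
qed

section \<open>The descending cop\<close>

text \<open>
  Each cop that is a proper ancestor of the robber descends one level towards him. The distance
  need not shrink, but the level of the cop increases.
\<close>

definition chase :: "nat list cop_strategy" where
  "chase h = (let y = snd (last h) in
     map (\<lambda>c. if strict_suffix c y then drop (length y - Suc (length c)) y else c) (fst (last h)))"

text \<open>Words grow at the head, so ancestors of \<open>y\<close> are its suffixes; the suffix
  one letter longer than \<open>c\<close> is the child of \<open>c\<close> towards
  \<open>y\<close>.\<close>

lemma strict_suffix_drop:
  assumes "strict_suffix c y"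
  obtains a where "drop (length y - Suc (length c)) y = a # c"
proof -
  obtain zs where y: "y = zs @ c" and "zs \<noteq> []"
    using assms by (auto simp: strict_suffix_def suffix_def)
  then have "drop (length y - Suc (length c)) y = last zs # c"
    by (cases zs rule: rev_cases) auto
  then show ?thesis
    by (rule that)
qed

lemma chase_in_cop_strategies: "chase \<in> cop_strategies (regular_tree d k)"
proof -
  have "drop (length y - Suc (length c)) y \<in> nbrs (regular_tree d k) c"
    if cy: "strict_suffix c y" "c \<in> pverts (regular_tree d k)" "y \<in> pverts (regular_tree d k)" for c y
  proof -
    obtain a where a: "drop (length y - Suc (length c)) y = a # c"
      using cy(1) by (rule strict_suffix_drop)
    moreover have "set (drop (length y - Suc (length c)) y) \<subseteq> set y"
      by (rule set_drop_subset)
    moreover have "length (drop (length y - Suc (length c)) y) \<le> length y"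
      by simp
    ultimately show ?thesis
      using cy(2,3) by (auto simp: mem_nbrs_regular_tree pverts_regular_tree)
  qed
  then show ?thesis
    by (auto simp: cop_strategies_def cops_move_def chase_def Let_def list_all2_conv_all_nth subset_iff)
qed

text \<open>As long as there is no capture, the cop is the ancestor of the robber at level
  \<open>t\<close> after \<open>t\<close> rounds. At level \<open>k\<close> this leaves no room
  below him.\<close>

lemma chase_catches:
  assumes "lazy_walk (regular_tree d k) (robber_at [[]] y chase \<rho>)"
  shows "\<exists>t\<le>k. caught_in_round [[]] y chase \<rho> t"
proof (rule ccontr)
  assume "\<not> ?thesis"
  then have free: "\<not> caught_in_round [[]] y chase \<rho> t" if "t \<le> k" for t
    using that by blast
  let ?r = "robber_at [[]] y chase \<rho>"
  have "t \<le> k \<Longrightarrow> \<exists>c. cops_at [[]] y chase \<rho> t = [c] \<and> suffix c (?r t) \<and> length c = t" for t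
  proof (induction t)
    case (Suc t)
    then obtain c where c: "cops_at [[]] y chase \<rho> t = [c]" "suffix c (?r t)" "length c = t"
      by auto
    have "c \<noteq> ?r t"
      using free[of t] Suc.prems c(1) by (auto simp: caught_in_round_def)
    then have strict: "strict_suffix c (?r t)"
      using c(2) by (simp add: strict_suffix_def)
    define c' where "c' = drop (length (?r t) - Suc (length c)) (?r t)"
    have cops: "cops_at [[]] y chase \<rho> (Suc t) = [c']"
      using strict by (simp add: cops_at_Suc chase_def Let_def last_play c(1) c'_def)
    obtain a where "c' = a # c"
      unfolding c'_def using strict by (rule strict_suffix_drop)
    then have len: "length c' = Suc t"
      using c(3) by simp
    \<comment> \<open>The robber is strictly below the new cop position, so even a step up keeps him
      in its subtree.\<close>
    have "c' \<noteq> ?r t"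
      using free[of "Suc t"] Suc.prems cops by (auto simp: caught_in_round_def)
    then obtain z zs where z: "?r t = z # zs @ c'"
      unfolding c'_def using suffix_drop[of "length (?r t) - Suc (length c)" "?r t"]
      by (metis append_Nil list.exhaust append_Cons suffix_def)
    have "?r (Suc t) = ?r t \<or> (\<exists>j. ?r (Suc t) = j # ?r t \<or> ?r t = j # ?r (Suc t))"
      using assms by (auto simp: lazy_walk_def mem_nbrs_regular_tree)
    then have "suffix c' (?r (Suc t))"
      unfolding z by (auto simp: suffix_def) metis
    then show ?case
      using cops len by blast
  qed simp
  from this[of k] obtain c where c: "cops_at [[]] y chase \<rho> k = [c]" "suffix c (?r k)" "length c = k"
    by auto
  have "length (?r k) \<le> k"
    using lazy_walk_in_verts[OF pair_graph_regular_tree assms, of k] by (simp add: pverts_regular_tree)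
  then have "c = ?r k"
    using c(2,3) by (auto simp: suffix_def)
  then have "caught_in_round [[]] y chase \<rho> k"
    using c(1) by (simp add: caught_in_round_def)
  then show False
    using free by blast
qed

lemma capture_time_chase_le:
  assumes "lazy_walk (regular_tree d k) (robber_at [[]] y chase \<rho>)"
  shows "capture_time [[]] y chase \<rho> \<le> enat k"
  using chase_catches[OF assms] by (blast intro: capture_time_le)

section \<open>Cop number and capture time of the tree\<close>

text \<open>One cop succeeds by \<open>chase\<close>. Without cops the position stays the empty
  list, and even a motionless robber is never caught.\<close>

lemma cop_number_regular_tree: "cop_number (regular_tree d k) = 1"
  unfolding cop_number_def
proof (rule Least_equality)
  let ?T = "regular_tree d k"
  have "[[]] \<in> cop_positions ?T 1"
    by (simp add: cop_positions_def)
  moreover have "\<exists>t. caught_in_round [[]] y chase \<rho> t"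
    if "y \<in> pverts ?T" "\<rho> \<in> robber_strategies ?T" for y \<rho>
    using that chase_catches[of d k y \<rho>]
      lazy_walk_robber_at[OF pair_graph_regular_tree chase_in_cop_strategies, of \<rho> d k "[[]]" y]
    by auto
  ultimately show "\<exists>x\<in>cop_positions ?T 1. \<exists>\<sigma>\<in>cop_strategies ?T. \<forall>y\<in>pverts ?T.
      \<forall>\<rho>\<in>robber_strategies ?T. \<exists>t. caught_in_round x y \<sigma> \<rho> t"
    using chase_in_cop_strategies by blast
next
  let ?T = "regular_tree d k"
  fix m
  assume *: "\<exists>x\<in>cop_positions ?T m. \<exists>\<sigma>\<in>cop_strategies ?T. \<forall>y\<in>pverts ?T.
      \<forall>\<rho>\<in>robber_strategies ?T. \<exists>t. caught_in_round x y \<sigma> \<rho> t"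
  show "1 \<le> m"
  proof (rule ccontr)
    assume "\<not> 1 \<le> m"
    then have "m = 0"
      by simp
    then have "cop_positions ?T m = {[]}"
      by (auto simp: cop_positions_def)
    then obtain \<sigma> where \<sigma>: "\<sigma> \<in> cop_strategies ?T"
      and caught: "\<And>y \<rho>. y \<in> pverts ?T \<Longrightarrow> \<rho> \<in> robber_strategies ?T \<Longrightarrow>
        \<exists>t. caught_in_round [] y \<sigma> \<rho> t"
      using * by auto
    have "cops_at [] [] \<sigma> stay t = []" for t
    proof (induction t)
      case (Suc t)
      then show ?case
        using cops_at_in_verts(2)[OF pair_graph_regular_tree \<sigma>, of "[]" "[]" stay t]
        by (simp add: cops_move_def)
    qed simp
    then show False
      using caught[OF Nil_in_regular_tree stay_in_robber_strategies]
      by (simp add: caught_in_round_def)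
  qed
qed

lemma ct_regular_tree:
  assumes "d \<ge> 2"
  shows "ct (regular_tree d k) = enat k"
proof (rule antisym)
  let ?T = "regular_tree d k"
  have "ct_from ?T [[]] y \<le> enat k" if "y \<in> pverts ?T" for y
    unfolding ct_from_def
    using that lazy_walk_robber_at[OF pair_graph_regular_tree chase_in_cop_strategies, of _ d k "[[]]" y]
    by (intro INF_lower2[OF chase_in_cop_strategies] SUP_least capture_time_chase_le) auto
  then show "ct ?T \<le> enat k"
    unfolding ct_def ct_cops_def cop_number_regular_tree
    by (intro INF_lower2[of "[[]]"] SUP_least) (auto simp: cop_positions_def)
  have "enat k \<le> (SUP y\<in>pverts ?T. ct_from ?T x y)" if x: "x \<in> cop_positions ?T 1" for x
  proof -
    obtain c where c: "x = [c]" "c \<in> pverts ?T"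
      using x by (cases x) (auto simp: cop_positions_def)
    \<comment> \<open>The last letter of a word names its branch at the root. The leaf
      \<open>y\<close> is put in a branch other than that of \<open>c\<close>; two letters suffice,
      and \<open>d \<ge> 2\<close> provides them.\<close>
    define a where "a = (if c \<noteq> [] \<and> last c = 0 then 1 else 0 :: nat)"
    define y where "y = replicate k a"
    have y: "y \<in> pverts ?T"
      using assms by (auto simp: y_def a_def pverts_regular_tree)
    text \<open>The path from \<open>c\<close> to \<open>y\<close> goes through the root, since they end in different letters.\<close>
    have far: "k \<le> t" if y_ball: "y \<in> graph_ball ?T c t" for t
    proof -
      obtain i p where ip: "i \<le> t" "y = p @ drop i c" "length p \<le> t - i"
        using subsetD[OF graph_ball_regular_tree_subset y_ball] by blast
      have "drop i c = []"
      proof (rule ccontr)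
        assume ne: "drop i c \<noteq> []"
        then have "last y = last c" "y \<noteq> []" "c \<noteq> []"
          using ip(2) by (auto simp: last_append)
        then show False
          by (auto simp: y_def a_def split: if_splits)
      qed
      then have "k = length p"
        using ip(2) by (metis append_Nil2 length_replicate y_def)
      then show ?thesis
        using ip(3) by simp
    qed
    have "enat k \<le> ct_from ?T x y"
      unfolding ct_from_def
    proof (rule INF_greatest, rule SUP_upper2[OF stay_in_robber_strategies], rule capture_time_ge)
      fix \<sigma> t
      assume "\<sigma> \<in> cop_strategies ?T" "caught_in_round x y \<sigma> stay t"
      then have "y \<in> graph_ball ?T c t"
        using caught_in_graph_ball[OF pair_graph_regular_tree _ c(2), of \<sigma> y stay t] y
        by (simp add: c(1))
      then show "k \<le> t"
        by (rule far)
    qed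
    then show ?thesis
      using y by (meson SUP_upper2)
  qed
  then show "enat k \<le> ct ?T"
    unfolding ct_def ct_cops_def cop_number_regular_tree by (intro INF_greatest)
qed

section \<open>Bounds on the drunk capture time of the tree\<close>

text \<open>From the root, \<open>chase\<close> captures by round \<open>k\<close> for every start
  and almost every trajectory, so the average obeys the same bound.\<close>

lemma dct_regular_tree_le: "dct (regular_tree d k) \<le> of_nat k"
proof -
  let ?T = "regular_tree d k"
  interpret pair_graph ?T by (rule pair_graph_regular_tree)
  have "dct_from ?T [[]] y \<le> of_nat k" if y: "y \<in> pverts ?T" for y
  proof -
    interpret prob_space "drunk_walk ?T y"
      by (rule prob_space_drunk_walk)
    have "AE w in drunk_walk ?T y. ennreal_of_enat (capture_time [[]] y chase (follow w)) \<le> of_nat k"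
      using AE_drunk_walk[OF pair_graph_regular_tree y]
    proof eventually_elim
      case (elim w)
      then have "capture_time [[]] y chase (follow w) \<le> enat k"
        by (intro capture_time_chase_le[where d = d]) (simp add: robber_at_follow)
      then have "ennreal_of_enat (capture_time [[]] y chase (follow w)) \<le> ennreal_of_enat (enat k)"
        by (simp only: ennreal_of_enat_le_iff)
      then show ?case
        by simp
    qed
    then have "(\<integral>\<^sup>+w. ennreal_of_enat (capture_time [[]] y chase (follow w)) \<partial>drunk_walk ?T y) \<le>
        (\<integral>\<^sup>+w. of_nat k \<partial>drunk_walk ?T y)"
      by (rule nn_integral_mono_AE)
    also have "\<dots> = of_nat k"
      using emeasure_space_1 by simp
    finally show ?thesis
      unfolding dct_from_def by (rule INF_lower2[OF chase_in_cop_strategies])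
  qed
  then have "(\<Sum>y\<in>pverts ?T. dct_from ?T [[]] y) \<le> of_nat (card (pverts ?T)) * of_nat k"
    by (rule sum_bounded_above)
  then have "(\<Sum>y\<in>pverts ?T. dct_from ?T [[]] y) / of_nat (card (pverts ?T)) \<le>
      of_nat k * of_nat (card (pverts ?T)) / of_nat (card (pverts ?T))"
    by (intro divide_right_mono_ennreal) (simp add: mult.commute)
  also have "\<dots> = of_nat k"
    by (rule ennreal_mult_divide_eq)
      (auto simp: card_eq_0_iff intro: Nil_in_regular_tree)
  finally show ?thesis
    unfolding dct_def dct_cops_def cop_number_regular_tree
    by (intro INF_lower2[of "[[]]"]) (auto simp: cop_positions_def)
qed

lemma dct_regular_tree_ge:
  assumes d: "d \<ge> 2"
  shows "of_nat k \<le> dct (regular_tree d k) + of_nat (16 * (d + 1))"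
\<comment> \<open>For \<open>k = 0\<close> the root is isolated and the degree bound does not apply,
  but the claim is trivial.\<close>
proof (cases "k = 0")
  case False
  \<comment> \<open>The constant collects 4 from the ball size, \<open>d + 1\<close> from the
    degree, 2 from the two times and 2 from the weighted power sum; the remaining
    \<open>d ^ k\<close> is at most the number of vertices.\<close>
  let ?T = "regular_tree d k" and ?C = "16 * (d + 1)"
  let ?n = "card (pverts ?T)"
  interpret pair_graph ?T by (rule pair_graph_regular_tree)
  have n: "?n \<noteq> 0"
    by (auto simp: card_eq_0_iff intro: Nil_in_regular_tree)
  have "of_nat k \<le> (\<Sum>y\<in>pverts ?T. dct_from ?T x y) / of_nat ?n + of_nat ?C"
    if x: "x \<in> cop_positions ?T 1" for x
  proof -
    obtain c where c: "x = [c]" "c \<in> pverts ?T"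
      using x by (cases x) (auto simp: cop_positions_def)
    have "(\<Sum>v\<in>graph_ball ?T c t. card (nbrs ?T v)) \<le> 4 * d ^ t * (d + 1)" for t
    proof -
      have "(\<Sum>v\<in>graph_ball ?T c t. card (nbrs ?T v)) \<le> card (graph_ball ?T c t) * (d + 1)"
        using sum_bounded_above[of "graph_ball ?T c t" "\<lambda>v. card (nbrs ?T v)" "d + 1"]
          card_nbrs_regular_tree_le by simp
      also have "\<dots> \<le> 4 * d ^ t * (d + 1)"
        by (intro mult_right_mono card_graph_ball_regular_tree_le d) simp
      finally show ?thesis .
    qed
    then have "(\<Sum>t<k. (k - t) * (2 * (\<Sum>v\<in>graph_ball ?T c t. card (nbrs ?T v)))) \<le>
        (\<Sum>t<k. (k - t) * (2 * (4 * d ^ t * (d + 1))))"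
      by (intro sum_mono mult_left_mono) auto
    also have "\<dots> = 8 * (d + 1) * (\<Sum>t<k. (k - t) * d ^ t)"
      by (subst sum_distrib_left) (rule sum.cong, simp_all add: algebra_simps)
    also have "\<dots> \<le> 8 * (d + 1) * (2 * d ^ k)"
      by (intro mult_left_mono sum_diff_mult_power_le d) simp
    also have "\<dots> \<le> ?C * ?n"
      using mult_left_mono[OF power_le_card_regular_tree[of d k], of ?C] by (simp add: algebra_simps)
    finally have le: "of_nat (\<Sum>t<k. (k - t) * (2 * (\<Sum>v\<in>graph_ball ?T c t. card (nbrs ?T v)))) \<le>
        (of_nat (?C * ?n) :: ennreal)"
      by (rule of_nat_mono)
    have "of_nat ?n * of_nat k \<le> (\<Sum>y\<in>pverts ?T. dct_from ?T x y) +
        of_nat (\<Sum>t<k. (k - t) * (2 * (\<Sum>v\<in>graph_ball ?T c t. card (nbrs ?T v))))"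
      unfolding c(1)
      by (intro sum_dct_from_lower_bound[OF pair_graph_regular_tree c(2)]
          nbrs_regular_tree_nonempty) (use d False in simp_all)
    also note add_left_mono[OF le]
    finally have "of_nat ?n * of_nat k \<le> (\<Sum>y\<in>pverts ?T. dct_from ?T x y) + of_nat (?C * ?n)" .
    then have "of_nat k * of_nat ?n / of_nat ?n \<le>
        ((\<Sum>y\<in>pverts ?T. dct_from ?T x y) + of_nat ?C * of_nat ?n) / of_nat ?n"
      by (intro divide_right_mono_ennreal) (simp add: mult.commute)
    then show ?thesis
      using n by (simp only: add_divide_distrib_ennreal ennreal_mult_divide_eq
        of_nat_eq_0_iff not_False_eq_True ennreal_of_nat_neq_top)
  qed
  then have "of_nat k - of_nat ?C \<le> dct ?T"
    unfolding dct_def dct_cops_def cop_number_regular_tree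
    by (intro INF_greatest) (simp only: ennreal_minus_le_iff add.commute
      ennreal_of_nat_neq_top simp_thms)
  then show ?thesis
    by (simp only: ennreal_minus_le_iff add.commute)
qed simp

text \<open>Finiteness is a separate conjunct because \<open>enn2real\<close> sends infinity to 0,
  which would make the upper bound on the real value uninformative.\<close>

theorem theorem3p4:
  fixes d :: nat
  assumes "d \<ge> 2"
  shows "(\<exists>f :: nat \<Rightarrow> real. f \<in> O(\<lambda>k. sqrt (real k * ln (real k))) \<and>
            (\<forall>k. dct (regular_tree d k) \<noteq> \<infinity> \<and>
                 real k - f k \<le> enn2real (dct (regular_tree d k)) \<and>
                 enn2real (dct (regular_tree d k)) \<le> real k))
       \<and> (\<lambda>k. enn2real (dct (regular_tree d k))) \<sim>[at_top] real
       \<and> ((\<lambda>k. drunkenness_cost (regular_tree d k)) \<longlonglongrightarrow> 1)"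
proof -
  define a where "a k = enn2real (dct (regular_tree d k))" for k
  define C where "C = real (16 * (d + 1))"
  have fin: "dct (regular_tree d k) \<noteq> \<infinity>" for k
    using dct_regular_tree_le[of d k] by (auto simp: top_unique)
  then have dct: "dct (regular_tree d k) = ennreal (a k)" for k
    by (simp add: a_def less_top)
  have a_nonneg: "0 \<le> a k" for k
    by (simp add: a_def)
  have upper: "a k \<le> real k" for k
    using dct_regular_tree_le[of d k] unfolding dct
    by (simp add: ennreal_of_nat_eq_real_of_nat)
  have "0 \<le> C"
    by (simp add: C_def)
  have lower: "real k - C \<le> a k" for k
  proof -
    have "ennreal (real k) \<le> ennreal (a k) + ennreal C"
      using dct_regular_tree_ge[OF assms, of k]
      unfolding dct C_def by (simp only: ennreal_of_nat_eq_real_of_nat)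
    then have "ennreal (real k) \<le> ennreal (a k + C)"
      using a_nonneg \<open>0 \<le> C\<close> by simp
    then show ?thesis
      using a_nonneg[of k] \<open>0 \<le> C\<close> by (simp del: ennreal_plus)
  qed
  \<comment> \<open>The loss is bounded by a constant, so the constant function serves as the error
    term.\<close>
  have "(\<lambda>_. C) \<in> O(\<lambda>k. sqrt (real k * ln (real k)))"
    by real_asymp
  moreover have ratio: "(\<lambda>k. a k / real k) \<longlonglongrightarrow> 1"
  proof (rule tendsto_sandwich)
    show "\<forall>\<^sub>F k in sequentially. (real k - C) / real k \<le> a k / real k"
      by (intro always_eventually allI divide_right_mono lower) simp
    show "\<forall>\<^sub>F k in sequentially. a k / real k \<le> 1"
      using eventually_gt_at_top[of 0] by eventually_elim (simp add: upper)
    show "(\<lambda>k. (real k - C) / real k) \<longlonglongrightarrow> 1"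
      by real_asymp
  qed simp
  moreover have "a \<sim>[at_top] real"
    using ratio by (rule asymp_equivI'_const[where c = 1, simplified])
  moreover have "(\<lambda>k. drunkenness_cost (regular_tree d k)) \<longlonglongrightarrow> 1"
  proof -
    \<comment> \<open>Beyond this threshold the lower bound makes \<open>a k\<close> positive, so
      the extended quotient agrees with the real one.\<close>
    have "\<forall>\<^sub>F k in sequentially. ennreal (real k / a k) = drunkenness_cost (regular_tree d k)"
      using eventually_gt_at_top[of "16 * (d + 1)"]
    proof eventually_elim
      case (elim k)
      then have "C < real k"
        unfolding C_def by (simp only: of_nat_less_iff)
      then have "0 < a k"
        using lower[of k] by linarith
      then show ?case
        by (simp add: drunkenness_cost_def ct_regular_tree[OF assms] dct
            ennreal_of_nat_eq_real_of_nat divide_ennreal)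
    qed
    moreover have "(\<lambda>k. ennreal (real k / a k)) \<longlonglongrightarrow> ennreal 1"
      using tendsto_inverse[OF ratio] by (intro tendsto_ennrealI) simp
    ultimately show ?thesis
      by (simp add: Lim_transform_eventually)
  qed
  ultimately show ?thesis
    using fin upper lower unfolding a_def by (intro conjI exI[of _ "\<lambda>_. C"]) simp_all
qed

end
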